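(* Suppose $\phi$ is non-degenerate, $\dim D=\infty$, and $G=G_0\oplus\mathbb Za_0$ for some subgroup $G_0\leqslant G$ and some $a_0\in G\setminus\{0\}$. Let $X$ be a nontrivial simple bounded $W(\phi|_{G_0\times D})$-module and let $\Gamma=L(X,G_0,a_0)$. Then $\Gamma$ has a weight space that is not finite dimensional.
   Context: Let $G$ be a nonzero abelian group, $D$ a complex vector space, $\phi:G\times D\to\mathbb C$ additive in the first variable and $\mathbb C$-linear in the second. $\phi$ is non-degenerate if $\phi(G,d)=0$ implies $d=0$ and $\phi(a,D)=0$ implies $a=0$. Let $A=\mathbb C[G]$ with basis $t^a$. The generalized Witt algebra $W=A\otimes_{\mathbb C}D$ has bracket $[t^ad,t^{a'}d']=t^{a+a'}(\phi(a',d)d'-\phi(a,d')d)$, where $t^ad=t^a\otimes d$ and $d=t^0\otimes d$. For $G'\leqslant G$, $W(\phi|_{G'\times D})=\mathrm{span}\{t^ad\mid a\in G',d\in D\}$. A $W$-module (or $W(\phi|_{G'\times D})$-module) $M$ is a weight module if $M=\bigoplus_{\lambda\in D^*}M_\lambda$, with weight spaces $M_\lambda=\{v\mid d\cdot v=\lambda(d)v\ \forall d\in D\}$. It is bounded if it is a weight module and the $\dim M_\lambda$ are uniformly bounded. A module is trivial if the Lie algebra acts by zero. If $G=G_0\oplus\mathbb Za_0$, put $W^0=W(\phi|_{G_0\times D})$ and $W^{\pm}=\mathrm{span}\{t^ad\mid a\in G_0\pm\mathbb Na_0,d\in D\}$ ($\mathbb N$ = positive integers). For a simple weight $W^0$-module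 $X$, extended to $W^0\oplus W^+$ by $W^+X=0$, $L(X,G_0,a_0)$ is the unique simple quotient of $U(W)\otimes_{U(W^0\oplus W^+)}X$. *)

theory Defs
  imports Complex_Main "HOL-Library.Poly_Mapping"
begin

section \<open>Linear algebra\<close>

text \<open>
  A complex vector space is a type of class \<open>ab_group_add\<close> with a scalar multiplication
  \<open>s\<close> satisfying \<^locale>\<open>vector_space\<close>; \<open>(*)\<close> is the scalar multiplication of the ground field.
\<close>

definition dual :: "(complex \<Rightarrow> 'd \<Rightarrow> 'd::ab_group_add) \<Rightarrow> ('d \<Rightarrow> complex) set" where
  "dual s = {f. Vector_Spaces.linear s (*) f}"

text \<open>
  The library's \<open>vector_space.dim\<close> is \<open>0\<close> on infinite-dimensional subspaces, so finiteness of the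
  dimension has to be stated separately.
\<close>

definition fin_dim :: "(complex \<Rightarrow> 'm \<Rightarrow> 'm::ab_group_add) \<Rightarrow> 'm set \<Rightarrow> bool" where
  "fin_dim s V \<longleftrightarrow> (\<exists>B. finite B \<and> V \<subseteq> module.span s B)"

definition is_direct_sum :: "'i set \<Rightarrow> ('i \<Rightarrow> 'm::ab_group_add set) \<Rightarrow> bool" where
  "is_direct_sum I V \<longleftrightarrow>
     (\<forall>v. \<exists>!f :: 'i \<Rightarrow>\<^sub>0 'm. Poly_Mapping.keys f \<subseteq> I \<and>
        (\<forall>i\<in>Poly_Mapping.keys f. Poly_Mapping.lookup f i \<in> V i) \<and>
        v = (\<Sum>i\<in>Poly_Mapping.keys f. Poly_Mapping.lookup f i))"

text \<open>
  Pointwise scalar multiplication on \<open>'i \<Rightarrow>\<^sub>0 'm\<close>, the direct sum of copies of \<open>'m\<close> indexed by \<open>'i\<close>;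
  \<open>pm_scale (*)\<close> is that of the free vector space \<open>'i \<Rightarrow>\<^sub>0 complex\<close> with basis \<open>'i\<close>.
\<close>

definition pm_scale ::
  "(complex \<Rightarrow> 'm \<Rightarrow> 'm) \<Rightarrow> complex \<Rightarrow> ('i \<Rightarrow>\<^sub>0 'm::ab_group_add) \<Rightarrow> ('i \<Rightarrow>\<^sub>0 'm)" where
  "pm_scale s c f = Poly_Mapping.map (s c) f"


section \<open>Modules over a Lie algebra\<close>

text \<open>
  The Lie algebra has underlying vector space \<open>('w, sw)\<close> and bracket \<open>br\<close>. The argument \<open>S\<close> is a Lie
  subalgebra: modules over \<open>S\<close> are given by an action \<open>act\<close> of which only the values on \<open>S\<close> matter.
\<close>

definition lie_module ::
  "(complex \<Rightarrow> 'w \<Rightarrow> 'w::ab_group_add) \<Rightarrow> ('w \<Rightarrow> 'w \<Rightarrow> 'w) \<Rightarrow> 'w set \<Rightarrow>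
   (complex \<Rightarrow> 'm \<Rightarrow> 'm::ab_group_add) \<Rightarrow> ('w \<Rightarrow> 'm \<Rightarrow> 'm) \<Rightarrow> bool" where
  "lie_module sw br S sm act \<longleftrightarrow>
     vector_space sm \<and>
     (\<forall>x\<in>S. Vector_Spaces.linear sm sm (act x)) \<and>
     (\<forall>x\<in>S. \<forall>y\<in>S. \<forall>v. act (x + y) v = act x v + act y v) \<and>
     (\<forall>c. \<forall>x\<in>S. \<forall>v. act (sw c x) v = sm c (act x v)) \<and>
     (\<forall>x\<in>S. \<forall>y\<in>S. \<forall>v. act (br x y) v = act x (act y v) - act y (act x v))"

definition simple_module ::
  "'w set \<Rightarrow> (complex \<Rightarrow> 'm \<Rightarrow> 'm::ab_group_add) \<Rightarrow> ('w \<Rightarrow> 'm \<Rightarrow> 'm) \<Rightarrow> bool" where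
  "simple_module S sm act \<longleftrightarrow>
     (\<exists>v::'m. v \<noteq> 0) \<and>
     (\<forall>N. module.subspace sm N \<and> (\<forall>x\<in>S. \<forall>v\<in>N. act x v \<in> N) \<longrightarrow> N = {0} \<or> N = UNIV)"

definition trivial_module :: "'w set \<Rightarrow> ('w \<Rightarrow> 'm \<Rightarrow> 'm::ab_group_add) \<Rightarrow> bool" where
  "trivial_module S act \<longleftrightarrow> (\<forall>x\<in>S. \<forall>v. act x v = 0)"


section \<open>Universal enveloping algebras and induced modules\<close>

text \<open>Words under concatenation, i.e. the free monoid, written additively as \<open>\<Rightarrow>\<^sub>0\<close> requires.\<close>

datatype 'a word = Word (letters: "'a list")

instantiation word :: (type) monoid_add
begin

definition zero_word :: "'a word" where
  "0 = Word []"

definition plus_word :: "'a word \<Rightarrow> 'a word \<Rightarrow> 'a word" where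
  "u + v = Word (letters u @ letters v)"

instance
  by standard (simp_all add: zero_word_def plus_word_def)

end

text \<open>
  The ring \<open>'w free_alg\<close>, with its multiplication from \<open>Poly_Mapping\<close>, is the free associative
  unital complex algebra on the set \<open>'w\<close>. The algebra \<open>U('w)\<close> is its quotient by
  \<open>env_ideal\<close>; the first two families of \<open>env_rels\<close> turn it into the tensor algebra of the vector
  space \<open>'w\<close>.
\<close>

type_synonym 'w free_alg = "'w word \<Rightarrow>\<^sub>0 complex"

definition gen :: "'w \<Rightarrow> 'w free_alg" where
  "gen x = Poly_Mapping.single (Word [x]) 1"

definition env_rels ::
  "(complex \<Rightarrow> 'w \<Rightarrow> 'w::ab_group_add) \<Rightarrow> ('w \<Rightarrow> 'w \<Rightarrow> 'w) \<Rightarrow> 'w free_alg set" where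
  "env_rels sw br =
     {gen (x + y) - gen x - gen y | x y. True} \<union>
     {gen (sw c x) - pm_scale (*) c (gen x) | c x. True} \<union>
     {gen x * gen y - gen y * gen x - gen (br x y) | x y. True}"

definition env_ideal ::
  "(complex \<Rightarrow> 'w \<Rightarrow> 'w::ab_group_add) \<Rightarrow> ('w \<Rightarrow> 'w \<Rightarrow> 'w) \<Rightarrow> 'w free_alg set" where
  "env_ideal sw br =
     module.span (pm_scale (*)) {u * r * u' | u r u'. r \<in> env_rels sw br}"

text \<open>
  Elements of \<open>U(S)\<close>, for a subalgebra \<open>S\<close>, are represented by elements of the free algebra all of
  whose letters lie in \<open>S\<close>; \<open>env_act\<close> is their action on an \<open>S\<close>-module, with the word
  \<open>x\<^sub>1 \<dots> x\<^sub>n\<close> acting by \<open>v \<mapsto> x\<^sub>1 (\<dots> (x\<^sub>n v))\<close>.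
\<close>

definition free_subalg :: "'w set \<Rightarrow> 'w free_alg set" where
  "free_subalg S = {u. \<forall>k\<in>Poly_Mapping.keys u. set (letters k) \<subseteq> S}"

definition env_act ::
  "(complex \<Rightarrow> 'x \<Rightarrow> 'x::ab_group_add) \<Rightarrow> ('w \<Rightarrow> 'x \<Rightarrow> 'x) \<Rightarrow> 'w free_alg \<Rightarrow> 'x \<Rightarrow> 'x" where
  "env_act sx act u x =
     (\<Sum>k\<in>Poly_Mapping.keys u. sx (Poly_Mapping.lookup u k) (foldr act (letters k) x))"

text \<open>
  For an \<open>S\<close>-module \<open>X\<close>, the induced module \<open>U('w) \<otimes>\<^bsub>U(S)\<^esub> X\<close> is the quotient of the free vector
  space \<open>('w, 'x) pre_tensor\<close> on the pairs \<open>(u, x)\<close> by the span of \<open>tensor_rels\<close>. These make the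
  tensor symbol bilinear, kill the pairs with \<open>u\<close> in \<open>env_ideal\<close> (so that the first factor
  only counts in \<open>U('w)\<close>), and identify \<open>u q \<otimes> x\<close> with \<open>u \<otimes> q x\<close> for \<open>q\<close> in \<open>U(S)\<close>.
\<close>

type_synonym ('w, 'x) pre_tensor = "('w free_alg \<times> 'x) \<Rightarrow>\<^sub>0 complex"

definition tens :: "'w free_alg \<Rightarrow> 'x \<Rightarrow> ('w, 'x) pre_tensor" where
  "tens u x = Poly_Mapping.single (u, x) 1"

definition tensor_rels ::
  "(complex \<Rightarrow> 'w \<Rightarrow> 'w::ab_group_add) \<Rightarrow> ('w \<Rightarrow> 'w \<Rightarrow> 'w) \<Rightarrow> 'w set \<Rightarrow>
   (complex \<Rightarrow> 'x \<Rightarrow> 'x::ab_group_add) \<Rightarrow> ('w \<Rightarrow> 'x \<Rightarrow> 'x) \<Rightarrow> ('w, 'x) pre_tensor set" where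
  "tensor_rels sw br S sx act =
     {tens (u + u') x - tens u x - tens u' x | u u' x. True} \<union>
     {tens u (x + x') - tens u x - tens u x' | u x x'. True} \<union>
     {tens (pm_scale (*) c u) x - pm_scale (*) c (tens u x) | c u x. True} \<union>
     {tens u (sx c x) - pm_scale (*) c (tens u x) | c u x. True} \<union>
     {tens u x | u x. u \<in> env_ideal sw br} \<union>
     {tens (u * q) x - tens u (env_act sx act q x) | u q x. q \<in> free_subalg S}"

text \<open>The action \<open>w (u \<otimes> x) = (w u) \<otimes> x\<close>.\<close>

definition tensor_act :: "'w \<Rightarrow> ('w, 'x) pre_tensor \<Rightarrow> ('w, 'x) pre_tensor" where
  "tensor_act w t =
     (\<Sum>(u, x)\<in>Poly_Mapping.keys t.
        pm_scale (*) (Poly_Mapping.lookup t (u, x)) (tens (gen w * u) x))"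

text \<open>
  The module \<open>(sm, act')\<close> is a quotient of \<open>U('w) \<otimes>\<^bsub>U(S)\<^esub> X\<close>: it is the image of a module
  homomorphism \<open>p\<close>, given on \<open>pre_tensor\<close> as a linear map killing the relations.
\<close>

definition quotient_of_induced ::
  "(complex \<Rightarrow> 'w \<Rightarrow> 'w::ab_group_add) \<Rightarrow> ('w \<Rightarrow> 'w \<Rightarrow> 'w) \<Rightarrow> 'w set \<Rightarrow>
   (complex \<Rightarrow> 'x \<Rightarrow> 'x::ab_group_add) \<Rightarrow> ('w \<Rightarrow> 'x \<Rightarrow> 'x) \<Rightarrow>
   (complex \<Rightarrow> 'm \<Rightarrow> 'm::ab_group_add) \<Rightarrow> ('w \<Rightarrow> 'm \<Rightarrow> 'm) \<Rightarrow> bool" where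
  "quotient_of_induced sw br S sx act sm act' \<longleftrightarrow>
     (\<exists>p :: ('w, 'x) pre_tensor \<Rightarrow> 'm.
        Vector_Spaces.linear (pm_scale (*)) sm p \<and> surj p \<and>
        (\<forall>r\<in>tensor_rels sw br S sx act. p r = 0) \<and>
        (\<forall>w t. p (tensor_act w t) = act' w (p t)))"


section \<open>Generalized Witt algebras\<close>

definition pairing ::
  "(complex \<Rightarrow> 'd \<Rightarrow> 'd::ab_group_add) \<Rightarrow> ('g::ab_group_add \<Rightarrow> 'd \<Rightarrow> complex) \<Rightarrow> bool" where
  "pairing sd \<phi> \<longleftrightarrow>
     vector_space sd \<and>
     (\<forall>a b d. \<phi> (a + b) d = \<phi> a d + \<phi> b d) \<and>
     (\<forall>a. Vector_Spaces.linear sd (*) (\<phi> a))"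

definition nondegenerate ::
  "('g::ab_group_add \<Rightarrow> 'd::ab_group_add \<Rightarrow> complex) \<Rightarrow> bool" where
  "nondegenerate \<phi> \<longleftrightarrow>
     (\<forall>d. (\<forall>a. \<phi> a d = 0) \<longrightarrow> d = 0) \<and> (\<forall>a. (\<forall>d. \<phi> a d = 0) \<longrightarrow> a = 0)"

text \<open>
  \<open>\<complex>[G] \<otimes> D\<close> is the direct sum of the spaces \<open>t\<^sup>a \<otimes> D\<close>, each a copy of \<open>D\<close>, and is represented
  by the finitely supported functions from \<open>G\<close> to \<open>D\<close>.
\<close>

type_synonym ('g, 'd) witt = "'g \<Rightarrow>\<^sub>0 'd"

definition tD :: "'g \<Rightarrow> 'd::ab_group_add \<Rightarrow> ('g, 'd) witt" where
  "tD a d = Poly_Mapping.single a d"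

definition witt_bracket ::
  "(complex \<Rightarrow> 'd \<Rightarrow> 'd) \<Rightarrow> ('g::ab_group_add \<Rightarrow> 'd::ab_group_add \<Rightarrow> complex) \<Rightarrow>
   ('g, 'd) witt \<Rightarrow> ('g, 'd) witt \<Rightarrow> ('g, 'd) witt" where
  "witt_bracket sd \<phi> x y =
     (\<Sum>a\<in>Poly_Mapping.keys x. \<Sum>a'\<in>Poly_Mapping.keys y.
        let d = Poly_Mapping.lookup x a; d' = Poly_Mapping.lookup y a'
        in tD (a + a') (sd (\<phi> a' d) d' - sd (\<phi> a d') d))"

definition witt_on ::
  "(complex \<Rightarrow> 'd \<Rightarrow> 'd::ab_group_add) \<Rightarrow> 'g set \<Rightarrow> ('g, 'd) witt set" where
  "witt_on sd H = module.span (pm_scale sd) {tD a d | a d. a \<in> H}"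

abbreviation witt_module ::
  "(complex \<Rightarrow> 'd \<Rightarrow> 'd::ab_group_add) \<Rightarrow> ('g::ab_group_add \<Rightarrow> 'd \<Rightarrow> complex) \<Rightarrow>
   ('g, 'd) witt set \<Rightarrow> (complex \<Rightarrow> 'm \<Rightarrow> 'm::ab_group_add) \<Rightarrow>
   (('g, 'd) witt \<Rightarrow> 'm \<Rightarrow> 'm) \<Rightarrow> bool" where
  "witt_module sd \<phi> \<equiv> lie_module (pm_scale sd) (witt_bracket sd \<phi>)"

definition weight_space ::
  "(complex \<Rightarrow> 'm \<Rightarrow> 'm::ab_group_add) \<Rightarrow> (('g::ab_group_add, 'd::ab_group_add) witt \<Rightarrow> 'm \<Rightarrow> 'm) \<Rightarrow>
   ('d \<Rightarrow> complex) \<Rightarrow> 'm set" where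
  "weight_space sm act \<mu> = {v. \<forall>d. act (tD 0 d) v = sm (\<mu> d) v}"

definition weight_module ::
  "(complex \<Rightarrow> 'd \<Rightarrow> 'd::ab_group_add) \<Rightarrow> (complex \<Rightarrow> 'm \<Rightarrow> 'm::ab_group_add) \<Rightarrow>
   (('g::ab_group_add, 'd) witt \<Rightarrow> 'm \<Rightarrow> 'm) \<Rightarrow> bool" where
  "weight_module sd sm act \<longleftrightarrow> is_direct_sum (dual sd) (weight_space sm act)"

definition bounded_module ::
  "(complex \<Rightarrow> 'd \<Rightarrow> 'd::ab_group_add) \<Rightarrow> (complex \<Rightarrow> 'm \<Rightarrow> 'm::ab_group_add) \<Rightarrow>
   (('g::ab_group_add, 'd) witt \<Rightarrow> 'm \<Rightarrow> 'm) \<Rightarrow> bool" where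
  "bounded_module sd sm act \<longleftrightarrow>
     weight_module sd sm act \<and>
     (\<exists>n. \<forall>\<mu>\<in>dual sd. fin_dim sm (weight_space sm act \<mu>) \<and>
                     vector_space.dim sm (weight_space sm act \<mu>) \<le> n)"


section \<open>The modules $L(X, G_0, a_0)$\<close>

definition add_subgroup :: "'g::ab_group_add set \<Rightarrow> bool" where
  "add_subgroup H \<longleftrightarrow> 0 \<in> H \<and> (\<forall>a\<in>H. \<forall>b\<in>H. a - b \<in> H)"

definition nat_multiple :: "nat \<Rightarrow> 'g::ab_group_add \<Rightarrow> 'g" where
  "nat_multiple n a = ((+) a ^^ n) 0"

definition int_multiples :: "'g::ab_group_add \<Rightarrow> 'g set" where
  "int_multiples a = {nat_multiple n a | n. True} \<union> {- nat_multiple n a | n. True}"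

definition splits_as :: "'g::ab_group_add set \<Rightarrow> 'g \<Rightarrow> bool" where
  "splits_as G0 a0 \<longleftrightarrow>
     G0 \<inter> int_multiples a0 = {0} \<and> (\<forall>g. \<exists>h\<in>G0. \<exists>z\<in>int_multiples a0. g = h + z)"

definition witt_plus ::
  "(complex \<Rightarrow> 'd \<Rightarrow> 'd::ab_group_add) \<Rightarrow> 'g::ab_group_add set \<Rightarrow> 'g \<Rightarrow> ('g, 'd) witt set" where
  "witt_plus sd G0 a0 = witt_on sd {g + nat_multiple n a0 | g n. g \<in> G0 \<and> n > 0}"

definition witt_parabolic ::
  "(complex \<Rightarrow> 'd \<Rightarrow> 'd::ab_group_add) \<Rightarrow> 'g::ab_group_add set \<Rightarrow> 'g \<Rightarrow> ('g, 'd) witt set" where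
  "witt_parabolic sd G0 a0 = {x + y | x y. x \<in> witt_on sd G0 \<and> y \<in> witt_plus sd G0 a0}"

text \<open>
  Restricting the support to \<open>G0\<close> projects \<open>W\<^sup>0 \<oplus> W\<^sup>+\<close> onto \<open>W\<^sup>0\<close> with kernel \<open>W\<^sup>+\<close>, so
  \<open>extend_by_zero\<close> is the action of \<open>W\<^sup>0 \<oplus> W\<^sup>+\<close> that extends that of \<open>W\<^sup>0\<close> and
  satisfies \<open>W\<^sup>+ X = 0\<close>.
\<close>

definition supp_restrict :: "'g set \<Rightarrow> ('g, 'd::ab_group_add) witt \<Rightarrow> ('g, 'd) witt" where
  "supp_restrict H w = (\<Sum>a\<in>Poly_Mapping.keys w \<inter> H. tD a (Poly_Mapping.lookup w a))"

definition extend_by_zero ::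
  "'g set \<Rightarrow> (('g, 'd::ab_group_add) witt \<Rightarrow> 'x \<Rightarrow> 'x) \<Rightarrow> ('g, 'd) witt \<Rightarrow> 'x \<Rightarrow> 'x" where
  "extend_by_zero G0 act w = act (supp_restrict G0 w)"

text \<open>
  The module \<open>(sm, act')\<close> is (isomorphic to) \<open>L(X, G\<^sub>0, a\<^sub>0)\<close> for the \<open>W\<^sup>0\<close>-module \<open>X = (sx, act)\<close>.
\<close>

definition is_L ::
  "(complex \<Rightarrow> 'd \<Rightarrow> 'd::ab_group_add) \<Rightarrow> ('g::ab_group_add \<Rightarrow> 'd \<Rightarrow> complex) \<Rightarrow> 'g set \<Rightarrow> 'g \<Rightarrow>
   (complex \<Rightarrow> 'x \<Rightarrow> 'x::ab_group_add) \<Rightarrow> (('g, 'd) witt \<Rightarrow> 'x \<Rightarrow> 'x) \<Rightarrow>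
   (complex \<Rightarrow> 'm \<Rightarrow> 'm::ab_group_add) \<Rightarrow> (('g, 'd) witt \<Rightarrow> 'm \<Rightarrow> 'm) \<Rightarrow> bool" where
  "is_L sd \<phi> G0 a0 sx act sm act' \<longleftrightarrow>
     witt_module sd \<phi> UNIV sm act' \<and>
     simple_module UNIV sm act' \<and>
     quotient_of_induced (pm_scale sd) (witt_bracket sd \<phi>) (witt_parabolic sd G0 a0)
       sx (extend_by_zero G0 act) sm act'"

end

theory Submission
  imports Defs
begin

text \<open>
  Let \<open>\<iota> x = 1 \<otimes> x\<close> be the canonical map from \<open>X\<close> to \<open>\<Gamma>\<close>, let \<open>x\<close> be a weight vector and suppose that
  the weight spaces of \<open>\<Gamma>\<close> are finite dimensional. Let \<open>c \<in> G\<^sub>0\<close>. As \<open>D\<close> is infinite dimensional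
  and all \<open>t\<^bsup>-a\<^sub>0\<^esup>d \<cdot> \<iota> x\<close> lie in one weight space, there is some \<open>d\<^sub>0 \<noteq> 0\<close> with
  \<open>t\<^bsup>-a\<^sub>0\<^esup>d\<^sub>0 \<cdot> \<iota> x = 0\<close> and \<open>\<phi>(a\<^sub>0, d\<^sub>0) = \<phi>(c, d\<^sub>0) = 0\<close>, and non-degeneracy gives \<open>b \<in> G\<^sub>0\<close> with
  \<open>\<phi>(b, d\<^sub>0) \<noteq> 0\<close>. Applying \<open>t\<^bsup>b+a\<^sub>0\<^esup>e\<close>, which annihilates \<open>\<iota> x\<close>, gives
  \<open>t\<^sup>b(\<phi>(-a\<^sub>0, e)d\<^sub>0 - \<phi>(b, d\<^sub>0)e) \<cdot> \<iota> x = 0\<close> for all \<open>e\<close>. The case \<open>e = d\<^sub>0\<close> and then the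
  general case show that \<open>t\<^sup>bD\<close> annihilates \<open>\<iota> x\<close>. So does \<open>t\<^bsup>c-b\<^esup>D\<close>, since
  \<open>\<phi>(c - b, d\<^sub>0) \<noteq> 0\<close>, and the brackets of these two spaces contain \<open>t\<^sup>cD\<close>. Hence \<open>\<iota>\<close> kills
  \<open>W\<^sup>0X\<close>, so that \<open>X\<close> is trivial or \<open>\<iota> = 0\<close>; the latter forces \<open>\<Gamma> = 0\<close>.
\<close>

section \<open>Linear algebra\<close>

text \<open>Rank-nullity: lift a finite basis of the image to \<open>A\<close> in \<open>S\<close>;
  each element of \<open>S\<close> differs from one of \<open>span A\<close> by an element of the
  kernel. Working relative to a subspace \<open>S\<close> allows several kernels to be intersected
  one after another.\<close>

lemma linear_kernel_not_fin_dim: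
  fixes s1 :: "complex \<Rightarrow> 'a::ab_group_add \<Rightarrow> 'a" and s2 :: "complex \<Rightarrow> 'b::ab_group_add \<Rightarrow> 'b"
  assumes lin: "Vector_Spaces.linear s1 s2 T"
    and S: "module.subspace s1 S" and inf: "\<not> fin_dim s1 S" and fin: "fin_dim s2 (T ` S)"
  shows "\<not> fin_dim s1 {x \<in> S. T x = 0}"
proof
  interpret T: Vector_Spaces.linear s1 s2 T by fact
  assume "fin_dim s1 {x \<in> S. T x = 0}"
  then obtain C where C: "finite C" "{x \<in> S. T x = 0} \<subseteq> T.vs1.span C"
    by (auto simp: fin_dim_def)
  obtain B where B: "finite B" "T ` S \<subseteq> T.vs2.span B"
    using fin by (auto simp: fin_dim_def)
  obtain B' where B': "B' \<subseteq> T ` S" "T.vs2.independent B'" "T ` S \<subseteq> T.vs2.span B'"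
    by (rule T.vs2.maximal_independent_subset)
  have "finite B'"
    using T.vs2.independent_span_bound[OF B(1) B'(2)] B' B by blast
  then obtain A where A: "A \<subseteq> S" "finite A" "B' = T ` A"
    using B'(1) finite_subset_image by metis
  have "x \<in> T.vs1.span (A \<union> C)" if x: "x \<in> S" for x
  proof -
    have "T x \<in> T ` T.vs1.span A"
      using B'(3) A(3) x T.span_image by auto
    then obtain a where a: "a \<in> T.vs1.span A" "T x = T a" by auto
    have "T.vs1.span A \<subseteq> S"
      using A(1) S T.vs1.span_minimal by blast
    then have "x - a \<in> {x \<in> S. T x = 0}"
      using a x S by (auto simp: T.diff intro: T.vs1.subspace_diff)
    then have "x - a \<in> T.vs1.span C"
      using C(2) by blast
    then have "a + (x - a) \<in> T.vs1.span (A \<union> C)"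
      using a(1) by (meson T.vs1.span_add T.vs1.span_mono Un_upper1 Un_upper2 in_mono)
    then show ?thesis by simp
  qed
  then show False
    using inf A(2) C(1) unfolding fin_dim_def by (meson finite_UnI subsetI)
qed

lemma fin_dim_scalars: "fin_dim (*) (V :: complex set)"
proof -
  interpret vector_space "(*) :: complex \<Rightarrow> complex \<Rightarrow> complex"
    by unfold_locales (auto simp: algebra_simps)
  have "V \<subseteq> span {1}"
    by (auto simp: span_singleton)
  then show ?thesis
    unfolding fin_dim_def by blast
qed

lemma vector_space_pm_scale:
  assumes "vector_space s"
  shows "vector_space (pm_scale s :: complex \<Rightarrow> ('i \<Rightarrow>\<^sub>0 'm::ab_group_add) \<Rightarrow> _)"
proof -
  interpret vector_space s by fact
  have lookup: "Poly_Mapping.lookup (pm_scale s c f) i = s c (Poly_Mapping.lookup f i)"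
    for c i and f :: "'i \<Rightarrow>\<^sub>0 'm"
    by (simp add: pm_scale_def map.rep_eq when_def)
  show ?thesis
    by unfold_locales (auto intro!: poly_mapping_eqI simp: lookup lookup_add algebra_simps)
qed

section \<open>Induced modules\<close>

text \<open>The map is x \<mapsto> 1 \<otimes> x followed by the quotient map \<open>p\<close>. The
  balancing relation moves a letter of \<open>S\<close> across the tensor sign, and 1 \<otimes> X
  generates the induced module, so \<iota> = 0 leaves only the zero module.\<close>

lemma quotient_of_induced_map:
  fixes sx :: "complex \<Rightarrow> 'x::ab_group_add \<Rightarrow> 'x" and sm :: "complex \<Rightarrow> 'm::ab_group_add \<Rightarrow> 'm"
  assumes q: "quotient_of_induced sw br S sx act sm act'"
    and mod: "lie_module sw br UNIV sm act'" and vs: "vector_space sx"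
  shows "\<exists>\<iota>. Vector_Spaces.linear sx sm \<iota> \<and>
    (\<forall>w\<in>S. \<forall>x. act' w (\<iota> x) = \<iota> (act w x)) \<and> ((\<forall>x. \<iota> x = 0) \<longrightarrow> (\<forall>v::'m. v = 0))"
proof -
  obtain p where p: "Vector_Spaces.linear (pm_scale (*)) sm p" "surj p"
    and rel: "\<And>r. r \<in> tensor_rels sw br S sx act \<Longrightarrow> p r = 0"
    and pact: "\<And>w t. p (tensor_act w t) = act' w (p t)"
    using q unfolding quotient_of_induced_def by blast
  interpret p: Vector_Spaces.linear "pm_scale (*)" sm p by fact
  interpret X: vector_space sx by fact
  let ?\<iota> = "\<lambda>x. p (tens 1 x)"
  have add_l: "p (tens (u + u') x) = p (tens u x) + p (tens u' x)" for u u' x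
  proof -
    have "tens (u + u') x - tens u x - tens u' x \<in> tensor_rels sw br S sx act"
      unfolding tensor_rels_def by blast
    from rel[OF this] show ?thesis by (simp add: p.diff p.add algebra_simps)
  qed
  have add_r: "p (tens u (x + x')) = p (tens u x) + p (tens u x')" for u x x'
  proof -
    have "tens u (x + x') - tens u x - tens u x' \<in> tensor_rels sw br S sx act"
      unfolding tensor_rels_def by blast
    from rel[OF this] show ?thesis by (simp add: p.diff p.add algebra_simps)
  qed
  have scale_l: "p (tens (pm_scale (*) c u) x) = sm c (p (tens u x))" for c u x
  proof -
    have "tens (pm_scale (*) c u) x - pm_scale (*) c (tens u x) \<in> tensor_rels sw br S sx act"
      unfolding tensor_rels_def by blast
    from rel[OF this] show ?thesis by (simp add: p.diff p.scale)
  qed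
  have scale_r: "p (tens u (sx c x)) = sm c (p (tens u x))" for c u x
  proof -
    have "tens u (sx c x) - pm_scale (*) c (tens u x) \<in> tensor_rels sw br S sx act"
      unfolding tensor_rels_def by blast
    from rel[OF this] show ?thesis by (simp add: p.diff p.scale)
  qed
  have balanced: "p (tens (u * v) x) = p (tens u (env_act sx act v x))"
    if "v \<in> free_subalg S" for u v x
  proof -
    have "tens (u * v) x - tens u (env_act sx act v x) \<in> tensor_rels sw br S sx act"
      unfolding tensor_rels_def using that by blast
    from rel[OF this] show ?thesis by (simp add: p.diff)
  qed
  have gen_l: "p (tens (gen w * u) x) = act' w (p (tens u x))" for w u x
  proof -
    have "tensor_act w (tens u x) = tens (gen w * u) x"
      by (simp add: tensor_act_def tens_def pm_scale_def)
    then show ?thesis using pact[of w "tens u x"] by simp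
  qed
  have act_zero: "act' w 0 = 0" for w
  proof -
    interpret l: Vector_Spaces.linear sm sm "act' w"
      using mod unfolding lie_module_def by blast
    show ?thesis by (rule l.zero)
  qed
  show ?thesis
  proof (intro exI[of _ ?\<iota>] conjI ballI allI)
    show "Vector_Spaces.linear sx sm ?\<iota>"
      unfolding Vector_Spaces.linear_iff
      using add_r scale_r X.vector_space_axioms p.vs2.vector_space_axioms by blast
    show "act' w (?\<iota> x) = ?\<iota> (act w x)" if "w \<in> S" for w x
    proof -
      have "gen w \<in> free_subalg S"
        using that by (simp add: gen_def free_subalg_def)
      from balanced[OF this, of 1 x] gen_l[of w 1 x] show ?thesis
        by (simp add: env_act_def gen_def)
    qed
    show "(\<forall>x. ?\<iota> x = 0) \<longrightarrow> (\<forall>v::'m. v = 0)"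
    proof
      assume zero: "\<forall>x. ?\<iota> x = 0"
      \<comment> \<open>Letters are peeled off from the left, each turning into an action on a
        vector that is already 0; the empty word is a multiple of 1 \<otimes> x.\<close>
      have word: "p (tens (Poly_Mapping.single (Word ws) c) x) = 0" for ws c x
      proof (induction ws)
        case Nil
        have "Poly_Mapping.single (Word []) c = pm_scale (*) c (1 :: 'a free_alg)"
          by (simp add: pm_scale_def zero_word_def flip: single_one)
        then show ?case
          by (simp add: scale_l zero)
      next
        case (Cons w ws)
        have "Poly_Mapping.single (Word (w # ws)) c = gen w * Poly_Mapping.single (Word ws) c"
          by (simp add: gen_def mult_single plus_word_def)
        then show ?case
          by (simp add: gen_l Cons act_zero)
      qed
      have tens0: "p (tens u x) = 0" for u x
      proof (induction u rule: update_induct)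
        case const
        \<comment> \<open>The zero of the free algebra, seen as the empty word with coefficient
          0.\<close>
        show ?case using word[of "[]" 0] by simp
      next
        case (update f a b)
        have "Poly_Mapping.update a b f = f + Poly_Mapping.single a b"
          using update(1)
          by (auto intro!: poly_mapping_eqI simp: lookup_update lookup_add lookup_single in_keys_iff)
        then show ?case
          using update(3) word[of "letters a" b x] by (simp add: add_l)
      qed
      have "p t = 0" for t
      proof (induction t rule: update_induct)
        case const
        show ?case by simp
      next
        case (update f a b)
        have "Poly_Mapping.update a b f = f + pm_scale (*) b (tens (fst a) (snd a))"
          using update(1)
          by (auto intro!: poly_mapping_eqI
              simp: lookup_update lookup_add lookup_single in_keys_iff pm_scale_def tens_def)
        then show ?case
          using update(3) by (simp add: p.add p.scale tens0)
      qed
      then show "\<forall>v::'m. v = 0"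
        using p(2) by (metis surjD)
    qed
  qed
qed

section \<open>Generalized Witt algebras\<close>

lemma pairing_minus:
  assumes "pairing sd \<phi>"
  shows "\<phi> (- a) d = - \<phi> a d" "\<phi> (a - b) d = \<phi> a d - \<phi> b d"
proof -
  have add: "\<And>a b. \<phi> (a + b) d = \<phi> a d + \<phi> b d"
    using assms unfolding pairing_def by blast
  have "\<phi> 0 d = 0" using add[of 0 0] by simp
  then show minus: "\<phi> (- a) d = - \<phi> a d" for a
    using add[of a "- a"] by (simp add: eq_neg_iff_add_eq_0 add.commute)
  show "\<phi> (a - b) d = \<phi> a d - \<phi> b d"
    using add[of a "- b"] minus[of b] by simp
qed

lemma witt_bracket_tD:
  assumes "pairing sd \<phi>"
  shows "witt_bracket sd \<phi> (tD a d) (tD a' d') = tD (a + a') (sd (\<phi> a' d) d' - sd (\<phi> a d') d)"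
proof -
  interpret vector_space sd using assms unfolding pairing_def by blast
  have lin: "Vector_Spaces.linear sd (*) (\<phi> a)" for a
    using assms unfolding pairing_def by blast
  \<comment> \<open>Covers d = 0 or d' = 0: the double sum is then empty, so the right-hand side
    must vanish too.\<close>
  have "\<phi> a 0 = 0" for a
    using module_hom.zero[OF Vector_Spaces.linear.axioms(3)[OF lin]] .
  then show ?thesis
    by (auto simp: witt_bracket_def tD_def Let_def)
qed

lemma witt_on_tD:
  assumes "vector_space sd" "a \<in> H"
  shows "tD a d \<in> witt_on sd H"
proof -
  interpret vector_space "pm_scale sd" using vector_space_pm_scale[OF assms(1)] .
  show ?thesis
    unfolding witt_on_def using assms(2) by (auto intro: span_base)
qed

lemma zero_in_witt_on:
  assumes "vector_space sd"
  shows "0 \<in> witt_on sd H"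
proof -
  interpret vector_space "pm_scale sd" using vector_space_pm_scale[OF assms] .
  show ?thesis
    unfolding witt_on_def by (rule span_zero)
qed

lemma supp_restrict_tD:
  "supp_restrict H (tD a d) = (if a \<in> H then tD a d else 0)"
  by (auto simp: supp_restrict_def tD_def)

text \<open>Pairing with \<open>d\<close> vanishes on all multiples of \<open>a0\<close>, so a
  nonzero value must come from the component in \<open>G0\<close>.\<close>

lemma nondegenerate_obtain_G0:
  assumes "pairing sd \<phi>" "nondegenerate \<phi>" "splits_as G0 a0"
    and "d \<noteq> 0" "\<phi> a0 d = 0"
  obtains b where "b \<in> G0" "\<phi> b d \<noteq> 0"
proof -
  have add: "\<And>a b. \<phi> (a + b) d = \<phi> a d + \<phi> b d"
    using assms(1) unfolding pairing_def by blast
  have "\<phi> (nat_multiple n a0) d = 0" for n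
    using assms(5) add[of 0 0] by (induction n) (simp_all add: nat_multiple_def add)
  then have "\<phi> z d = 0" if "z \<in> int_multiples a0" for z
    using that pairing_minus[OF assms(1)] by (auto simp: int_multiples_def)
  moreover obtain a where "\<phi> a d \<noteq> 0"
    using assms(2,4) unfolding nondegenerate_def by blast
  ultimately show thesis
    using assms(3) that add unfolding splits_as_def by (metis add.right_neutral)
qed

text \<open>This follows from [d', t^a d] = \<phi>(a, d') t^a d. The new weight does not depend on
  \<open>d\<close>.\<close>

lemma weight_space_shift:
  assumes pair: "pairing sd \<phi>" and mod: "witt_module sd \<phi> UNIV sm act"
    and v: "v \<in> weight_space sm act \<mu>"
  shows "act (tD a d) v \<in> weight_space sm act (\<lambda>d'. \<mu> d' + \<phi> a d')"
proof -
  interpret D: vector_space sd using pair unfolding pairing_def by blast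
  interpret M: vector_space sm using mod unfolding lie_module_def by blast
  have zero: "\<phi> 0 d' = 0" for d'
    using pairing_minus(2)[OF pair, of 0 0] by simp
  have "act (tD 0 d') (act (tD a d) v) = sm (\<mu> d' + \<phi> a d') (act (tD a d) v)" for d'
  proof -
    have l: "Vector_Spaces.linear sm sm (act (tD a d))"
      using mod unfolding lie_module_def by blast
    have "act (witt_bracket sd \<phi> (tD 0 d') (tD a d)) v
        = act (tD 0 d') (act (tD a d) v) - act (tD a d) (act (tD 0 d') v)"
      using mod unfolding lie_module_def by blast
    moreover have "witt_bracket sd \<phi> (tD 0 d') (tD a d) = pm_scale sd (\<phi> a d') (tD a d)"
      by (simp add: witt_bracket_tD[OF pair] zero) (simp add: pm_scale_def tD_def)
    moreover have "act (pm_scale sd (\<phi> a d') (tD a d)) v = sm (\<phi> a d') (act (tD a d) v)"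
      using mod unfolding lie_module_def by blast
    moreover have "act (tD a d) (act (tD 0 d') v) = sm (\<mu> d') (act (tD a d) v)"
      using v l unfolding weight_space_def Vector_Spaces.linear_iff by simp
    ultimately show ?thesis
      by (simp add: M.scale_left_distrib algebra_simps)
  qed
  then show ?thesis
    by (simp add: weight_space_def)
qed

section \<open>Vectors annihilated by the subalgebra on \<open>G0\<close>\<close>

lemma linear_witt_action:
  fixes \<phi> :: "'g::ab_group_add \<Rightarrow> 'd::ab_group_add \<Rightarrow> complex"
  assumes "pairing sd \<phi>" "witt_module sd \<phi> UNIV sm act"
  shows "Vector_Spaces.linear sd sm (\<lambda>d. act (tD a d) v)"
proof -
  interpret D: vector_space sd using assms(1) unfolding pairing_def by blast
  have "tD a (d + d') = tD a d + tD a d'" for d d' :: 'd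
    by (simp add: tD_def single_add)
  moreover have "tD a (sd c d) = pm_scale sd c (tD a d)" for c d
    by (simp add: tD_def pm_scale_def)
  moreover have "act (w + w') v = act w v + act w' v" "act (pm_scale sd c w) v = sm c (act w v)"
    for w w' c
    using assms(2) unfolding lie_module_def by blast+
  moreover have "vector_space sm"
    using assms(2) unfolding lie_module_def by blast
  ultimately show ?thesis
    using D.vector_space_axioms unfolding Vector_Spaces.linear_iff by simp
qed

text \<open>Isolates what is used about the image of a weight vector: \<open>fin\<close> makes the
  kernel of the lowering map large, and \<open>top\<close> supplies the raising operators that
  transfer this to degree 0.\<close>

lemma highest_vector_annihilated:
  fixes \<phi> :: "'g::ab_group_add \<Rightarrow> 'd::ab_group_add \<Rightarrow> complex"
  assumes pair: "pairing sd \<phi>" and nd: "nondegenerate \<phi>"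
    and inf: "\<not> fin_dim sd (UNIV :: 'd set)"
    and G0: "add_subgroup G0" "splits_as G0 a0"
    and mod: "witt_module sd \<phi> UNIV sm act"
    and fin: "fin_dim sm (range (\<lambda>d. act (tD (- a0) d) v))"
    and top: "\<And>b e. b \<in> G0 \<Longrightarrow> act (tD (b + a0) e) v = 0"
    and c: "c \<in> G0"
  shows "act (tD c d) v = 0"
proof -
  interpret D: vector_space sd using pair unfolding pairing_def by blast
  interpret M: vector_space sm using mod unfolding lie_module_def by blast
  have \<phi>lin: "Vector_Spaces.linear sd (*) (\<phi> a)" for a
    using pair unfolding pairing_def by blast
  have \<phi>add: "\<And>a b d. \<phi> (a + b) d = \<phi> a d + \<phi> b d"
    using pair unfolding pairing_def by blast
  note minus = pairing_minus[OF pair]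
  have br: "act (tD (a + a') (sd (\<phi> a' d) d' - sd (\<phi> a d') d)) v
      = act (tD a d) (act (tD a' d') v) - act (tD a' d') (act (tD a d) v)" for a a' d d'
  proof -
    have "act (witt_bracket sd \<phi> (tD a d) (tD a' d')) v
        = act (tD a d) (act (tD a' d') v) - act (tD a' d') (act (tD a d) v)"
      using mod unfolding lie_module_def by blast
    then show ?thesis by (simp only: witt_bracket_tD[OF pair])
  qed
  have act0: "act w 0 = 0" for w
  proof -
    interpret l: Vector_Spaces.linear sm sm "act w"
      using mod unfolding lie_module_def by blast
    show ?thesis by (rule l.zero)
  qed
  have lin: "Vector_Spaces.linear sd sm (\<lambda>d. act (tD a d) v)" for a
    by (rule linear_witt_action[OF pair mod])
  have lin_rules:
    "act (tD a (x - y)) v = act (tD a x) v - act (tD a y) v"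
    "act (tD a (- x)) v = - act (tD a x) v"
    "act (tD a (sd k x)) v = sm k (act (tD a x) v)" for a x y k
  proof -
    interpret l: Vector_Spaces.linear sd sm "\<lambda>d. act (tD a d) v" by (rule lin)
    show "act (tD a (x - y)) v = act (tD a x) v - act (tD a y) v"
      "act (tD a (- x)) v = - act (tD a x) v"
      "act (tD a (sd k x)) v = sm k (act (tD a x) v)"
      by (simp_all add: l.diff l.neg l.scale)
  qed
  \<comment> \<open>The nesting mirrors three uses of \<open>linear_kernel_not_fin_dim\<close>; only
    a nonzero element \<open>d0\<close> of \<open>?K\<close> is wanted.\<close>
  let ?K = "{d \<in> {d \<in> {d \<in> UNIV. act (tD (- a0) d) v = 0}. \<phi> a0 d = 0}. \<phi> c d = 0}"
  have sub1: "D.subspace {d \<in> UNIV. act (tD (- a0) d) v = 0}"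
    using module_hom.subspace_kernel[OF Vector_Spaces.linear.axioms(3)[OF lin]] by simp
  have sub2: "D.subspace {d. \<phi> a0 d = 0}"
    using module_hom.subspace_kernel[OF Vector_Spaces.linear.axioms(3)[OF \<phi>lin]] .
  have sub: "D.subspace {d \<in> {d \<in> UNIV. act (tD (- a0) d) v = 0}. \<phi> a0 d = 0}"
    using D.subspace_inter[OF sub1 sub2] by (simp add: Int_def)
  have "\<not> fin_dim sd ?K"
    by (intro linear_kernel_not_fin_dim[OF \<phi>lin sub] linear_kernel_not_fin_dim[OF \<phi>lin sub1]
        linear_kernel_not_fin_dim[OF lin D.subspace_UNIV inf] fin fin_dim_scalars)
  then have "\<not> ?K \<subseteq> D.span {}"
    unfolding fin_dim_def by blast
  then obtain d0 where d0: "d0 \<noteq> 0" "act (tD (- a0) d0) v = 0" "\<phi> a0 d0 = 0" "\<phi> c d0 = 0"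
    by auto
  have kill: "act (tD b e) v = 0" if b: "b \<in> G0" "\<phi> b d0 \<noteq> 0" for b e
  proof -
    \<comment> \<open>Both products in the commutator of t^(b+a0) e and t^(-a0) d0 kill
      \<open>v\<close>. At e = d0 the left side is 0 because \<phi>(a0, d0) = 0.\<close>
    have eq: "sm (- \<phi> a0 e) (act (tD b d0) v) = sm (\<phi> b d0) (act (tD b e) v)" for e
      using br[of "b + a0" "- a0" e d0] top[OF b(1), of e] d0
      by (simp add: act0 lin_rules minus \<phi>add)
    from eq[of d0] have "act (tD b d0) v = 0"
      using b(2) d0(3) by simp
    with eq[of e] show ?thesis
      using b(2) by simp
  qed
  obtain b where b: "b \<in> G0" "\<phi> b d0 \<noteq> 0"
    using nondegenerate_obtain_G0[OF pair nd G0(2) d0(1) d0(3)] .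
  have b': "c - b \<in> G0" "\<phi> (c - b) d0 \<noteq> 0"
    using G0(1) b c d0(4) by (simp_all add: add_subgroup_def minus)
  \<comment> \<open>The bracket of t^b d0 and t^(c-b) e has degree \<open>c\<close>, and \<phi>(c -
    b, d0) = - \<phi>(b, d0) by the choice of \<open>d0\<close>.\<close>
  have eq: "sm (- \<phi> b d0) (act (tD c e) v) = sm (\<phi> b e) (act (tD c d0) v)" for e
    using br[of b "c - b" d0 e] kill[OF b] kill[OF b']
    by (simp add: act0 lin_rules minus d0(4))
  \<comment> \<open>At e = d0 the two coefficients are opposite, which leaves the nonzero factor 2
    \<phi>(b, d0).\<close>
  have "sm (\<phi> b d0 - - \<phi> b d0) (act (tD c d0) v) = 0"
    by (simp only: M.scale_left_diff_distrib eq[of d0]) simp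
  then have "act (tD c d0) v = 0"
    using b(2) by simp
  with eq[of d] show ?thesis
    using b(2) by simp
qed

section \<open>From weight vectors to all of \<open>X\<close>\<close>

theorem theorem5p11:
  fixes sd :: "complex \<Rightarrow> 'd::ab_group_add \<Rightarrow> 'd"
    and \<phi> :: "'g::ab_group_add \<Rightarrow> 'd \<Rightarrow> complex"
    and G0 :: "'g set" and a0 :: 'g
    and sx :: "complex \<Rightarrow> 'x::ab_group_add \<Rightarrow> 'x"
    and actX :: "('g, 'd) witt \<Rightarrow> 'x \<Rightarrow> 'x"
    and s\<Gamma> :: "complex \<Rightarrow> 'm::ab_group_add \<Rightarrow> 'm"
    and act\<Gamma> :: "('g, 'd) witt \<Rightarrow> 'm \<Rightarrow> 'm"
  assumes "pairing sd \<phi>"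
    and "nondegenerate \<phi>"
    and "\<not> fin_dim sd (UNIV :: 'd set)"
    and "add_subgroup G0"
    and "a0 \<noteq> 0"
    and "splits_as G0 a0"
    and "witt_module sd \<phi> (witt_on sd G0) sx actX"
    and "simple_module (witt_on sd G0) sx actX"
    and "bounded_module sd sx actX"
    and "\<not> trivial_module (witt_on sd G0) actX"
    and "is_L sd \<phi> G0 a0 sx actX s\<Gamma> act\<Gamma>"
  shows "\<exists>\<mu>\<in>dual sd. \<not> fin_dim s\<Gamma> (weight_space s\<Gamma> act\<Gamma> \<mu>)"
proof (rule ccontr)
  assume "\<not> (\<exists>\<mu>\<in>dual sd. \<not> fin_dim s\<Gamma> (weight_space s\<Gamma> act\<Gamma> \<mu>))"
  then have fin: "\<And>\<mu>. \<mu> \<in> dual sd \<Longrightarrow> fin_dim s\<Gamma> (weight_space s\<Gamma> act\<Gamma> \<mu>)" by blast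
  note pair = assms(1)
  have vsd: "vector_space sd" and \<phi>lin: "\<And>a. Vector_Spaces.linear sd (*) (\<phi> a)"
    using pair unfolding pairing_def by blast+
  have modX: "\<And>w. w \<in> witt_on sd G0 \<Longrightarrow> Vector_Spaces.linear sx sx (actX w)"
    "\<And>w w' x. \<lbrakk>w \<in> witt_on sd G0; w' \<in> witt_on sd G0\<rbrakk> \<Longrightarrow> actX (w + w') x = actX w x + actX w' x"
    "\<And>k w x. w \<in> witt_on sd G0 \<Longrightarrow> actX (pm_scale sd k w) x = sx k (actX w x)"
    and vsX: "vector_space sx"
    using assms(7) unfolding lie_module_def by blast+
  have mod: "witt_module sd \<phi> UNIV s\<Gamma> act\<Gamma>" and simp\<Gamma>: "simple_module UNIV s\<Gamma> act\<Gamma>"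
    and ind: "quotient_of_induced (pm_scale sd) (witt_bracket sd \<phi>) (witt_parabolic sd G0 a0)
       sx (extend_by_zero G0 actX) s\<Gamma> act\<Gamma>"
    using assms(11) unfolding is_L_def by blast+
  interpret X: vector_space sx by (rule vsX)
  interpret W: vector_space "pm_scale sd :: complex \<Rightarrow> ('g, 'd) witt \<Rightarrow> _"
    by (rule vector_space_pm_scale[OF vsd])
  obtain \<iota> where \<iota>lin: "Vector_Spaces.linear sx s\<Gamma> \<iota>"
    and \<iota>act: "\<And>w x. w \<in> witt_parabolic sd G0 a0 \<Longrightarrow> act\<Gamma> w (\<iota> x) = \<iota> (extend_by_zero G0 actX w x)"
    and \<iota>0: "(\<forall>x. \<iota> x = 0) \<longrightarrow> (\<forall>v::'m. v = 0)"
    using quotient_of_induced_map[OF ind mod vsX] by blast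
  interpret \<iota>: Vector_Spaces.linear sx s\<Gamma> \<iota> by (rule \<iota>lin)
  have zeroG0: "0 \<in> G0" using assms(4) unfolding add_subgroup_def by blast
  have actX0: "actX 0 x = 0" for x
    using modX(3)[OF zero_in_witt_on[OF vsd], of 0 x] by simp
  have parabolicI: "w + w' \<in> witt_parabolic sd G0 a0"
    if "w \<in> witt_on sd G0" "w' \<in> witt_plus sd G0 a0" for w w'
    using that unfolding witt_parabolic_def by blast
  have par0: "tD b e \<in> witt_parabolic sd G0 a0" if "b \<in> G0" for b e
  proof -
    have "0 \<in> witt_plus sd G0 a0"
      unfolding witt_plus_def by (rule zero_in_witt_on[OF vsd])
    from parabolicI[OF witt_on_tD[OF vsd that] this] show ?thesis by simp
  qed
  have act0: "act\<Gamma> (tD b e) (\<iota> x) = \<iota> (actX (tD b e) x)" if "b \<in> G0" for b e x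
    using \<iota>act[OF par0[OF that]] that by (simp add: extend_by_zero_def supp_restrict_tD)
  have top: "act\<Gamma> (tD (b + a0) e) (\<iota> x) = 0" if b: "b \<in> G0" for b e x
  proof -
    have a0: "nat_multiple 1 a0 = a0" by (simp add: nat_multiple_def)
    have "tD (b + a0) e \<in> witt_plus sd G0 a0"
      unfolding witt_plus_def
      by (rule witt_on_tD[OF vsd]) (use b a0 in \<open>metis (mono_tags, lifting) mem_Collect_eq zero_less_one\<close>)
    then have "tD (b + a0) e \<in> witt_parabolic sd G0 a0"
      using parabolicI[OF zero_in_witt_on[OF vsd]] by fastforce
    \<comment> \<open>Outside \<open>G0\<close> the restricted support is empty, so
      \<open>extend_by_zero\<close> acts as \<open>actX 0\<close>. Membership would put
      \<open>a0\<close> into the trivial intersection of \<open>G0\<close> with the multiples of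
      \<open>a0\<close>.\<close>
    moreover have "b + a0 \<notin> G0"
    proof
      assume "b + a0 \<in> G0"
      then have "(b + a0) - b \<in> G0" using b assms(4) unfolding add_subgroup_def by blast
      moreover have "a0 \<in> int_multiples a0"
        unfolding int_multiples_def using a0 by (metis (mono_tags, lifting) UnI1 mem_Collect_eq)
      ultimately show False using assms(5,6) unfolding splits_as_def by auto
    qed
    ultimately show ?thesis
      using \<iota>act by (simp add: extend_by_zero_def supp_restrict_tD actX0)
  qed
  have weight: "\<iota> (actX (tD c d) x) = 0"
    if c: "c \<in> G0" and x: "x \<in> weight_space sx actX \<mu>" and \<mu>: "\<mu> \<in> dual sd" for c d x \<mu>
  proof -
    have "\<iota> x \<in> weight_space s\<Gamma> act\<Gamma> \<mu>"
      using x act0[OF zeroG0] by (simp add: weight_space_def \<iota>.scale)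
    then have "act\<Gamma> (tD (- a0) d) (\<iota> x) \<in> weight_space s\<Gamma> act\<Gamma> (\<lambda>d'. \<mu> d' + \<phi> (- a0) d')" for d
      by (rule weight_space_shift[OF pair mod])
    moreover have "(\<lambda>d'. \<mu> d' + \<phi> (- a0) d') \<in> dual sd"
      using \<mu> \<phi>lin[of "- a0"] unfolding dual_def Vector_Spaces.linear_iff
      by (simp add: algebra_simps)
    \<comment> \<open>The whole range lies in one weight space, finite dimensional by the assumption
      to be refuted.\<close>
    ultimately have "fin_dim s\<Gamma> (range (\<lambda>d. act\<Gamma> (tD (- a0) d) (\<iota> x)))"
      using fin unfolding fin_dim_def by (meson image_subsetI subset_trans)
    from highest_vector_annihilated[OF pair assms(2,3,4,6) mod this top c, of d]
    show ?thesis by (simp add: act0[OF c])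
  qed
  have all: "\<iota> (actX (tD c d) x) = 0" if c: "c \<in> G0" for c d x
  proof -
    interpret l: Vector_Spaces.linear sx sx "actX (tD c d)"
      by (rule modX(1)[OF witt_on_tD[OF vsd c]])
    obtain f where f: "Poly_Mapping.keys f \<subseteq> dual sd"
      "\<forall>i\<in>Poly_Mapping.keys f. Poly_Mapping.lookup f i \<in> weight_space sx actX i"
      "x = (\<Sum>i\<in>Poly_Mapping.keys f. Poly_Mapping.lookup f i)"
      using assms(9) unfolding bounded_module_def weight_module_def is_direct_sum_def by blast
    show ?thesis
      unfolding f(3) l.sum \<iota>.sum using f(1,2) weight[OF c] by (intro sum.neutral) blast
  qed
  have "X.subspace {x. \<iota> x = 0}"
    by (rule \<iota>.subspace_kernel)
  moreover have W0: "\<iota> (actX w x) = 0" if "w \<in> witt_on sd G0" for w x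
  proof -
    \<comment> \<open>Membership is carried through the induction because \<open>actX\<close> is
      known to be additive only on \<open>witt_on sd G0\<close>.\<close>
    have "w \<in> witt_on sd G0 \<and> \<iota> (actX w x) = 0"
      using that unfolding witt_on_def
    proof (induction rule: W.span_induct_alt)
      case base
      show ?case using W.span_zero actX0 by simp
    next
      case (step k w w')
      then obtain a d where a: "a \<in> G0" "w = tD a d" by blast
      have w: "w \<in> witt_on sd G0" using a witt_on_tD[OF vsd] by simp
      then have kw: "pm_scale sd k w \<in> witt_on sd G0"
        unfolding witt_on_def by (rule W.span_scale)
      have w': "w' \<in> witt_on sd G0" using step by (simp add: witt_on_def)
      show ?case
        using modX(2)[OF kw w'] modX(3)[OF w] all[OF a(1)] a(2) step W.span_add kw w'
        by (simp add: witt_on_def \<iota>.add \<iota>.scale)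
    qed
    then show ?thesis by blast
  qed
  \<comment> \<open>The kernel of \<iota> is a submodule, since the action sends all of
    \<open>X\<close> into it.\<close>
  ultimately have "{x. \<iota> x = 0} = {0} \<or> {x. \<iota> x = 0} = UNIV"
    using assms(8) unfolding simple_module_def by blast
  then show False
  proof
    assume "{x. \<iota> x = 0} = {0}"
    then have "trivial_module (witt_on sd G0) actX"
      using W0 unfolding trivial_module_def by blast
    then show False using assms(10) by blast
  next
    assume "{x. \<iota> x = 0} = UNIV"
    then have "\<forall>x. \<iota> x = 0" by blast
    then have "\<forall>v::'m. v = 0" using \<iota>0 by blast
    then show False using simp\<Gamma> unfolding simple_module_def by blast
  qed
qed

end
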